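(* Let $(G_m)_{m\in\mathbb{Z}}$ be a generalized Fibonacci sequence, let $a,b$ be integers, let $n\ge 0$ be an integer, and let $x$ be a complex number such that $\Delta := 1-L_b x+(-1)^b x^2\neq 0$. Then $$\begin{aligned} \sum_{k=0}^n x^k k^4 G_{a+bk} = {}& -\frac{1}{\Delta}(n+1)^4 x^{n+1} P(1,n+1) \\ & - \frac{1}{\Delta^2} \left[ (4n^3+18n^2+28n+15) x^{n+2} P(2,n+2) - x P(2,1) \right] \\ & - \frac{2}{\Delta^3} \left[ (6n^2+24n+25) x^{n+3} P(3,n+3) - 7 x^2 P(3,2) \right] \\ & - \frac{12}{\Delta^4} \left[ (2n+5) x^{n+4} P(4,n+4) - 3 x^3 P(4,3) \right] \\ & - \frac{24}{\Delta^5} \left[ x^{n+5} P(5,n+5) - x^4 P(5,4) \right]. \end{aligned}$$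
   Context: A generalized Fibonacci sequence is a sequence $(G_m)_{m\in\mathbb{Z}}$ of complex numbers with $G_{m+2}=G_{m+1}+G_m$ for all integers $m$ (with arbitrary seed $G_0,G_1$). $L_m$ is the Lucas number: $L_0=2$, $L_1=1$, $L_{m+2}=L_{m+1}+L_m$ for all integers $m$ (including negative indices). For given $a,b,x$ and $G$, and for integers $v,w\ge 0$, $P(v,w) = \sum_{k=0}^v \binom{v}{k} (-1)^{(b+1)k} x^k G_{a+bw-bk}$. Convention: $x^0=1$, also for $x=0$. *)

theory Defs
  imports Complex_Main
begin

definition gen_fib :: "(int \<Rightarrow> complex) \<Rightarrow> bool" where
  "gen_fib G \<longleftrightarrow> (\<forall>m. G (m + 2) = G (m + 1) + G m)"

fun lucas_nonneg :: "nat \<Rightarrow> int" where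
  "lucas_nonneg 0 = 2"
| "lucas_nonneg (Suc 0) = 1"
| "lucas_nonneg (Suc (Suc n)) = lucas_nonneg (Suc n) + lucas_nonneg n"

text \<open>The value at \<open>n\<close> is the Lucas number of index \<open>-n\<close>, obtained by running the recurrence backwards.\<close>

fun lucas_nonpos :: "nat \<Rightarrow> int" where
  "lucas_nonpos 0 = 2"
| "lucas_nonpos (Suc 0) = -1"
| "lucas_nonpos (Suc (Suc n)) = lucas_nonpos n - lucas_nonpos (Suc n)"

definition lucas :: "int \<Rightarrow> int" where
  "lucas m = (if m \<ge> 0 then lucas_nonneg (nat m) else lucas_nonpos (nat (- m)))"

lemma lucas_0: "lucas 0 = 2"
  by (simp add: lucas_def)

lemma lucas_1: "lucas 1 = 1"
  by (simp add: lucas_def)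

lemma lucas_rec: "lucas (m + 2) = lucas (m + 1) + lucas m"
proof -
  consider "m \<ge> 0" | "m = -1" | "m \<le> -2" by linarith
  then show ?thesis
  proof cases
    case 1
    then have "nat (m + 2) = Suc (Suc (nat m))" "nat (m + 1) = Suc (nat m)" by auto
    with 1 show ?thesis by (simp add: lucas_def)
  next
    case 2
    then show ?thesis by (simp add: lucas_def)
  next
    case 3
    define n where "n = nat (- m - 2)"
    have m: "m = - int n - 2" using 3 by (simp add: n_def)
    have "lucas m = lucas_nonpos (Suc (Suc n))" "lucas (m + 1) = lucas_nonpos (Suc n)"
      by (simp_all add: m lucas_def nat_add_distrib flip: add.assoc)
    moreover have "lucas (m + 2) = lucas_nonpos n"
      by (cases n) (simp_all add: m lucas_def nat_add_distrib)
    ultimately show ?thesis by simp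
  qed
qed

text \<open>The exponent \<open>(b+1)k\<close> may be negative, hence the integer power of \<open>-1\<close>.\<close>

definition fibP :: "(int \<Rightarrow> complex) \<Rightarrow> int \<Rightarrow> int \<Rightarrow> complex \<Rightarrow> nat \<Rightarrow> nat \<Rightarrow> complex" where
  "fibP G a b x v w =
     (\<Sum>k = 0..v. of_nat (v choose k) * (-1) powi ((b + 1) * int k) * x ^ k
        * G (a + b * int w - b * int k))"

end

theory Submission
  imports Defs
begin

text \<open>
  If \<open>\<alpha>\<close>, \<open>\<beta>\<close> are the roots of \<open>t\<^sup>2 - L\<^sub>b t + (-1)\<^sup>b\<close>, then \<open>\<Delta> = (1 - \<alpha>x)(1 - \<beta>x)\<close>, and for the
  solution \<open>G\<^bsub>a+bk\<^esub> = \<alpha>\<^sup>k\<close> the quantity \<open>S(v,w) = x\<^sup>w P(v,w) / \<Delta>\<^sup>v\<close> is \<open>(\<alpha>x)\<^sup>w / (1 - \<alpha>x)\<^sup>v\<close>. Hence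
  \<open>S(v+1,w) - S(v+1,w+1) = S(v,w)\<close>, and this holds for every \<open>G\<close> by linear recurrences alone,
  without diagonalisation. Since \<open>S(0,k) = x\<^sup>k G\<^bsub>a+bk\<^esub>\<close>, the formula is iterated summation by parts;
  its coefficients are the successive forward differences of \<open>k\<^sup>4\<close> at \<open>n + 1\<close> and at \<open>0\<close>.
\<close>

lemma gen_fib_rec: "gen_fib G \<Longrightarrow> G (m + 2) = G (m + 1) + G m"
  by (simp add: gen_fib_def)

lemma gen_fib_eq_0:
  assumes "gen_fib f" "f 0 = 0" "f 1 = 0"
  shows "f b = 0"
proof -
  have "f b = 0 \<and> f (b + 1) = 0"
  proof (induction b rule: int_induct[where k = 0])
    case base
    show ?case using assms by simp
  next
    case (step1 i)
    then show ?case using gen_fib_rec[OF assms(1), of i] by (simp add: algebra_simps)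
  next
    case (step2 i)
    then show ?case using gen_fib_rec[OF assms(1), of "i - 1"] by (simp add: algebra_simps)
  qed
  then show ?thesis ..
qed

text \<open>For fixed \<open>m\<close> the defect \<open>f\<close> is itself a generalized Fibonacci
  sequence in \<open>b\<close>, zero at 0 and 1: the alternating sign turns the backward recurrence
  of \<open>G (m - b)\<close> into the forward one.\<close>

lemma gen_fib_add_lucas:
  assumes "gen_fib G"
  shows "G (m + b) = of_int (lucas b) * G m - (-1) powi b * G (m - b)"
proof -
  define f where "f b = G (m + b) - of_int (lucas b) * G m + (-1) powi b * G (m - b)" for b
  have "gen_fib f"
    unfolding gen_fib_def
  proof
    fix i :: int
    have "G (m + (i + 2)) = G (m + (i + 1)) + G (m + i)"
      using gen_fib_rec[OF assms, of "m + i"] by (simp add: algebra_simps)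
    moreover have "G (m - i) = G (m - (i + 1)) + G (m - (i + 2))"
      using gen_fib_rec[OF assms, of "m - i - 2"] by (simp add: algebra_simps)
    moreover have "(-1 :: complex) powi (i + 1) = - ((-1) powi i)"
      "(-1 :: complex) powi (i + 2) = (-1) powi i"
      by (simp_all add: power_int_add)
    ultimately show "f (i + 2) = f (i + 1) + f i"
      by (simp add: f_def lucas_rec algebra_simps)
  qed
  moreover have "f 0 = 0"
    by (simp add: f_def lucas_0)
  moreover have "f 1 = 0"
    using gen_fib_rec[OF assms, of "m - 1"] by (simp add: f_def lucas_1 add.commute[of m])
  ultimately have "f b = 0"
    by (rule gen_fib_eq_0)
  then show ?thesis
    by (simp add: f_def algebra_simps)
qed

lemma fibP_0: "fibP G a b x 0 w = G (a + b * int w)"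
  by (simp add: fibP_def)

lemma fibP_rec_index:
  assumes "gen_fib G"
  shows "fibP G a b x v (w + 2)
    = of_int (lucas b) * fibP G a b x v (w + 1) - (-1) powi b * fibP G a b x v w"
proof -
  have G: "G (a + b * int (w + 2) - b * int k)
      = of_int (lucas b) * G (a + b * int (w + 1) - b * int k)
        - (-1) powi b * G (a + b * int w - b * int k)" for k
    using gen_fib_add_lucas[OF assms, of "a + b * int (w + 1) - b * int k" b]
    by (simp add: algebra_simps)
  show ?thesis
    unfolding fibP_def G sum_distrib_left sum_subtractf[symmetric]
    by (intro sum.cong) (simp_all add: algebra_simps)
qed

text \<open>Pascal's rule: with E the shift of \<open>w\<close> by one, P(v, .) is (1 - (-1)^b x
  E^(-1))^v applied to the sequence G_(a+bw).\<close>

lemma fibP_Suc: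
  "fibP G a b x (Suc v) (w + 1) = fibP G a b x v (w + 1) - (-1) powi b * x * fibP G a b x v w"
proof -
  define t where "t k = ((-1) powi (b + 1) * x) ^ k * G (a + b * int (w + 1) - b * int k)" for k
  have t: "(-1) powi ((b + 1) * int k) * x ^ k * G (a + b * int (w + 1) - b * int k) = t k" for k
    by (simp add: t_def power_int_mult power_mult_distrib)
  \<comment> \<open>Lowering \<open>w\<close> by one has the same effect on the index of
    \<open>G\<close> as raising \<open>k\<close> by one.\<close>
  have t_Suc: "- ((-1) powi b) * x * ((-1) powi ((b + 1) * int k) * x ^ k
      * G (a + b * int w - b * int k)) = t (Suc k)" for k
  proof -
    have c: "- ((-1) powi b) = ((-1) powi (b + 1) :: complex)"
      by (simp add: power_int_add)
    have i: "a + b * int w - b * int k = a + b * int (w + 1) - b * int (Suc k)"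
      by (simp add: algebra_simps)
    show ?thesis
      unfolding c i by (simp add: t_def power_int_mult power_mult_distrib)
  qed
  have "fibP G a b x (Suc v) (w + 1) = (\<Sum>k\<le>Suc v. of_nat (Suc v choose k) * t k)"
    by (simp only: fibP_def atLeast0AtMost mult.assoc flip: t)
  also have "\<dots> = t 0 + (\<Sum>k\<le>v. of_nat (v choose Suc k) * t (Suc k))
      + (\<Sum>k\<le>v. of_nat (v choose k) * t (Suc k))"
    by (simp add: sum.atMost_Suc_shift sum.distrib algebra_simps del: sum.atMost_Suc)
  also have "t 0 + (\<Sum>k\<le>v. of_nat (v choose Suc k) * t (Suc k))
      = (\<Sum>k\<le>Suc v. of_nat (v choose k) * t k)"
    by (subst sum.atMost_Suc_shift) simp
  \<comment> \<open>The top term vanishes, since \<open>v choose Suc v\<close> is 0.\<close>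
  also have "\<dots> = (\<Sum>k\<le>v. of_nat (v choose k) * t k)"
    by simp
  also have "\<dots> = fibP G a b x v (w + 1)"
    by (simp only: fibP_def atLeast0AtMost mult.assoc flip: t)
  also have "(\<Sum>k\<le>v. of_nat (v choose k) * t (Suc k)) = - ((-1) powi b) * x * fibP G a b x v w"
    unfolding fibP_def atLeast0AtMost sum_distrib_left t_Suc[symmetric]
    by (intro sum.cong) (simp_all add: algebra_simps)
  finally show ?thesis
    by simp
qed

text \<open>Expanding both terms on the left by \<open>fibP_Suc\<close> and then P(v,w+2) by the
  recurrence in \<open>w\<close>, the contributions of P(v,w) cancel and P(v,w+1) collects the
  factor \<Delta>.\<close>

lemma fibP_telescope:
  assumes "gen_fib G"
  shows "x ^ (w + 1) * fibP G a b x (Suc v) (w + 1) - x ^ (w + 2) * fibP G a b x (Suc v) (w + 2)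
    = (1 - of_int (lucas b) * x + (-1) powi b * x ^ 2) * (x ^ (w + 1) * fibP G a b x v (w + 1))"
proof -
  have step: "fibP G a b x (Suc v) (w + 2)
      = fibP G a b x v (w + 2) - (-1) powi b * x * fibP G a b x v (w + 1)"
    using fibP_Suc[of G a b x v "w + 1"] by simp
  show ?thesis
    unfolding step fibP_Suc[of G a b x v w] fibP_rec_index[OF assms, of a b x v w]
    by (simp add: algebra_simps power2_eq_square)
qed

text \<open>There is no lower boundary term \<open>S 1 0\<close> because 0^4 = 0, so the recurrence
  is only used at second indices from 1 on. The lower differences are 1, 14, 36, 24.\<close>

lemma sum_fourth_power_by_parts:
  fixes S :: "nat \<Rightarrow> nat \<Rightarrow> 'a :: comm_ring_1"
  assumes S: "\<And>v w. S (Suc v) (w + 2) = S (Suc v) (w + 1) - S v (w + 1)"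
  shows "(\<Sum>k = 0..n. of_nat k ^ 4 * S 0 k) =
    - ((of_nat n + 1) ^ 4 * S 1 (n + 1))
    - ((4 * of_nat n ^ 3 + 18 * of_nat n ^ 2 + 28 * of_nat n + 15) * S 2 (n + 2) - S 2 1)
    - 2 * ((6 * of_nat n ^ 2 + 24 * of_nat n + 25) * S 3 (n + 3) - 7 * S 3 2)
    - 12 * ((2 * of_nat n + 5) * S 4 (n + 4) - 3 * S 4 3)
    - 24 * (S 5 (n + 5) - S 5 4)"
proof (induction n)
  case 0
  \<comment> \<open>The sum is 0 here; eliminating \<open>S 5 5\<close>, \<open>S 4 4\<close>,
    \<open>S 3 3\<close>, \<open>S 2 2\<close> in turn makes the right side collapse.\<close>
  have base: "S 2 2 = S 2 1 - S 1 1" "S 3 3 = S 3 2 - S 2 2"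
    "S 4 4 = S 4 3 - S 3 3" "S 5 5 = S 5 4 - S 4 4"
    using S[of 1 0] S[of 2 1] S[of 3 2] S[of 4 3] by (simp_all add: eval_nat_numeral)
  show ?case
    unfolding add_0 base by (simp add: algebra_simps)
next
  case (Suc n)
  \<comment> \<open>These lower the second index in each upper boundary term; the coefficients then
    match because each is the forward difference of the one before it.\<close>
  have r: "S 1 (n + 2) = S 1 (n + 1) - S 0 (n + 1)" "S 2 (n + 3) = S 2 (n + 2) - S 1 (n + 2)"
    "S 3 (n + 4) = S 3 (n + 3) - S 2 (n + 3)" "S 4 (n + 5) = S 4 (n + 4) - S 3 (n + 4)"
    "S 5 (n + 6) = S 5 (n + 5) - S 4 (n + 5)"
    using S[of 0 n] S[of 1 "n + 1"] S[of 2 "n + 2"] S[of 3 "n + 3"] S[of 4 "n + 4"]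
    by (simp_all add: eval_nat_numeral)
  have i: "Suc n + 1 = n + 2" "Suc n + 2 = n + 3" "Suc n + 3 = n + 4" "Suc n + 4 = n + 5"
    "Suc n + 5 = n + 6"
    by simp_all
  have "(\<Sum>k = 0..Suc n. of_nat k ^ 4 * S 0 k)
      = (\<Sum>k = 0..n. of_nat k ^ 4 * S 0 k) + (of_nat n + 1) ^ 4 * S 0 (n + 1)"
    by (simp add: add.commute)
  then show ?case
    unfolding Suc.IH i r of_nat_Suc
    by (simp add: algebra_simps power2_eq_square power3_eq_cube power4_eq_xxxx)
qed

theorem mainTheorem5:
  fixes G :: "int \<Rightarrow> complex" and a b :: int and n :: nat and x :: complex
  defines "P \<equiv> fibP G a b x"
    and "\<Delta> \<equiv> 1 - of_int (lucas b) * x + (-1) powi b * x ^ 2"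
  assumes "gen_fib G"
    and "\<Delta> \<noteq> 0"
  shows "(\<Sum>k = 0..n. x ^ k * of_nat k ^ 4 * G (a + b * int k)) =
    - (1 / \<Delta>) * (of_nat n + 1) ^ 4 * x ^ (n + 1) * P 1 (n + 1)
    - 1 / \<Delta> ^ 2 * ((4 * of_nat n ^ 3 + 18 * of_nat n ^ 2 + 28 * of_nat n + 15) * x ^ (n + 2) * P 2 (n + 2)
        - x * P 2 1)
    - 2 / \<Delta> ^ 3 * ((6 * of_nat n ^ 2 + 24 * of_nat n + 25) * x ^ (n + 3) * P 3 (n + 3)
        - 7 * x ^ 2 * P 3 2)
    - 12 / \<Delta> ^ 4 * ((2 * of_nat n + 5) * x ^ (n + 4) * P 4 (n + 4)
        - 3 * x ^ 3 * P 4 3)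
    - 24 / \<Delta> ^ 5 * (x ^ (n + 5) * P 5 (n + 5)
        - x ^ 4 * P 5 4)"
proof -
  define S where "S v w = x ^ w * P v w / \<Delta> ^ v" for v w
  have S_rec: "S (Suc v) (w + 2) = S (Suc v) (w + 1) - S v (w + 1)" for v w
  proof -
    have "S v (w + 1) = \<Delta> * (x ^ (w + 1) * P v (w + 1)) / \<Delta> ^ Suc v"
      using \<open>\<Delta> \<noteq> 0\<close> by (simp add: S_def)
    also have "\<dots> = S (Suc v) (w + 1) - S (Suc v) (w + 2)"
      unfolding S_def P_def diff_divide_distrib[symmetric]
        fibP_telescope[OF \<open>gen_fib G\<close>, of x w a b v] \<Delta>_def ..
    finally show ?thesis
      by simp
  qed
  have sum: "(\<Sum>k = 0..n. x ^ k * of_nat k ^ 4 * G (a + b * int k))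
      = (\<Sum>k = 0..n. of_nat k ^ 4 * S 0 k)"
    by (simp add: S_def P_def fibP_0 mult_ac)
  show ?thesis
    unfolding sum sum_fourth_power_by_parts[of S n, OF S_rec]
    unfolding S_def divide_inverse
    by (simp add: algebra_simps)
qed

end
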